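(* Let $k \ge 0$ be an integer and let $G$ be a graph on $n$ vertices with $e(G)$ edges, minimum degree $\delta$ and maximum degree $\Delta$. Then: (i) $\alpha_k(G) \le S_k(G) \le \frac{n-\Delta+k}{2} + \sqrt{\frac{(n-\Delta+k)^2}{4} + n\Delta - 2e(G)}$; (ii) $\omega_k(G) \le L_k(G) \le \frac{\delta+k+1}{2} + \sqrt{\frac{(\delta+k+1)^2}{4} - n\delta + 2e(G)}$. Moreover, all bounds are sharp for regular graphs.
   Context: Graphs are finite and simple; $n = |V(G)|$, $e(G)$ is the number of edges of $G$, $\deg(v)$ is the degree of $v$ in $G$ and $N(v)$ is its open neighborhood. For an integer $k \ge 0$: a set $A \subseteq V(G)$ is $k$-small if $\deg(v) \le n - |A| + k$ for every $v \in A$; a set $B \subseteq V(G)$ is $k$-large if $\deg(v) \ge |B| - k - 1$ for every $v \in B$. $S_k(G)$ and $L_k(G)$ are the maximum cardinalities of a $k$-small set and of a $k$-large set of $G$, respectively. A set $A \subseteq V(G)$ is $k$-independent if $|N(v) \cap A| \le k$ for every $v \in A$; $\alpha_k(G)$ is the maximum cardinality of a $k$-independent set. A set $B \subseteq V(G)$ is a $k$-near clique if $|N(v) \cap B| \ge |B| - k - 1$ for every $v \in B$; $\omega_k(G)$ is the maximum cardinality of a $k$-near clique. *)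

theory Defs
  imports Complex_Main "HOL-Library.Ramsey"
begin

text \<open>A graph is a pair of a vertex set \<open>V\<close> and an edge set \<open>E\<close> of two-element subsets of \<open>V\<close>, so that
  \<open>n = card V\<close> and \<open>e(G) = card E\<close>. Nonemptiness of \<open>V\<close> is required because the minimum and
  maximum degrees are undefined otherwise.\<close>

definition simple_graph :: "'a set \<Rightarrow> 'a set set \<Rightarrow> bool" where
  "simple_graph V E \<longleftrightarrow> finite V \<and> V \<noteq> {} \<and> E \<subseteq> nsets V 2"

definition nbhd :: "'a set \<Rightarrow> 'a set set \<Rightarrow> 'a \<Rightarrow> 'a set" where
  "nbhd V E v = {u \<in> V. {v, u} \<in> E}"

definition deg :: "'a set \<Rightarrow> 'a set set \<Rightarrow> 'a \<Rightarrow> nat" where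
  "deg V E v = card (nbhd V E v)"

definition min_deg :: "'a set \<Rightarrow> 'a set set \<Rightarrow> nat" where
  "min_deg V E = Min (deg V E ` V)"

definition max_deg :: "'a set \<Rightarrow> 'a set set \<Rightarrow> nat" where
  "max_deg V E = Max (deg V E ` V)"

definition regular :: "'a set \<Rightarrow> 'a set set \<Rightarrow> bool" where
  "regular V E \<longleftrightarrow> (\<exists>r. \<forall>v\<in>V. deg V E v = r)"

text \<open>Inequalities containing a subtraction are stated over \<open>int\<close>, as subtraction on \<open>nat\<close> truncates.\<close>

definition k_small :: "nat \<Rightarrow> 'a set \<Rightarrow> 'a set set \<Rightarrow> 'a set \<Rightarrow> bool" where
  "k_small k V E A \<longleftrightarrow>
     A \<subseteq> V \<and> (\<forall>v\<in>A. int (deg V E v) \<le> int (card V) - int (card A) + int k)"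

definition k_large :: "nat \<Rightarrow> 'a set \<Rightarrow> 'a set set \<Rightarrow> 'a set \<Rightarrow> bool" where
  "k_large k V E B \<longleftrightarrow>
     B \<subseteq> V \<and> (\<forall>v\<in>B. int (deg V E v) \<ge> int (card B) - int k - 1)"

definition k_independent :: "nat \<Rightarrow> 'a set \<Rightarrow> 'a set set \<Rightarrow> 'a set \<Rightarrow> bool" where
  "k_independent k V E A \<longleftrightarrow> A \<subseteq> V \<and> (\<forall>v\<in>A. card (nbhd V E v \<inter> A) \<le> k)"

definition k_near_clique :: "nat \<Rightarrow> 'a set \<Rightarrow> 'a set set \<Rightarrow> 'a set \<Rightarrow> bool" where
  "k_near_clique k V E B \<longleftrightarrow>
     B \<subseteq> V \<and> (\<forall>v\<in>B. int (card (nbhd V E v \<inter> B)) \<ge> int (card B) - int k - 1)"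

definition small_num :: "nat \<Rightarrow> 'a set \<Rightarrow> 'a set set \<Rightarrow> nat" where
  "small_num k V E = Max {card A | A. k_small k V E A}"

definition large_num :: "nat \<Rightarrow> 'a set \<Rightarrow> 'a set set \<Rightarrow> nat" where
  "large_num k V E = Max {card B | B. k_large k V E B}"

definition indep_num :: "nat \<Rightarrow> 'a set \<Rightarrow> 'a set set \<Rightarrow> nat" where
  "indep_num k V E = Max {card A | A. k_independent k V E A}"

definition near_clique_num :: "nat \<Rightarrow> 'a set \<Rightarrow> 'a set set \<Rightarrow> nat" where
  "near_clique_num k V E = Max {card B | B. k_near_clique k V E B}"

definition small_bound :: "nat \<Rightarrow> 'a set \<Rightarrow> 'a set set \<Rightarrow> real" where
  "small_bound k V E =
     (let n = real (card V); D = real (max_deg V E); m = real (card E)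
      in (n - D + real k) / 2 + sqrt ((n - D + real k)\<^sup>2 / 4 + n * D - 2 * m))"

definition large_bound :: "nat \<Rightarrow> 'a set \<Rightarrow> 'a set set \<Rightarrow> real" where
  "large_bound k V E =
     (let n = real (card V); d = real (min_deg V E); m = real (card E)
      in (d + real k + 1) / 2 + sqrt ((d + real k + 1)\<^sup>2 / 4 - n * d + 2 * m))"

text \<open>Sharpness has two parts. The second inequality of each chain is an equality for every regular
  graph, as long as its right-hand side, which is then \<open>n - \<Delta> + k\<close> or \<open>\<delta> + k + 1\<close>, does not exceed
  the trivial bound \<open>n\<close>: these are the conditions \<open>k \<le> \<Delta>\<close> and \<open>\<delta> + k + 1 \<le> n\<close>, without which
  equality is impossible. The first inequality of each chain can be strict for regular graphs (for
  the 5-cycle and \<open>k = 0\<close>, the four numbers in the two chains are \<open>2 < 3\<close> and \<open>2 < 3\<close>); that it is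
  sharp means that there are regular graphs attaining equality throughout the chain. They exist for
  each order \<open>n > k\<close>; for regular graphs with \<open>n \<le> k\<close> the right-hand sides exceed \<open>n\<close>.\<close>

end

theory Submission
  imports Defs
begin

text \<open>Both upper bounds come from splitting the degree sum \<open>2 e(G)\<close> over an extremal set and its
  complement. If \<open>A\<close> is \<open>k\<close>-small with \<open>|A| = s\<close>, then
  \<open>2 e(G) \<le> s (n - s + k) + (n - s) \<Delta>\<close>, a quadratic inequality in \<open>s\<close> whose larger root is the
  claimed bound; large sets are dual. For regular graphs \<open>n \<Delta> = 2 e(G)\<close>, so the root is
  \<open>n - \<Delta> + k\<close>, and every vertex set of that size is \<open>k\<close>-small. Any \<open>k + 1\<close> vertices are both
  \<open>k\<close>-independent and a \<open>k\<close>-near clique, and the two bounds equal \<open>k + 1\<close> for complete and for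
  edgeless graphs, respectively, so there each chain collapses.\<close>

section \<open>Maxima over families of vertex sets\<close>

lemma finite_card_Collect:
  assumes "finite V" "\<And>A. P A \<Longrightarrow> A \<subseteq> V"
  shows "finite {card A | A. P A}"
proof -
  have "{card A | A. P A} \<subseteq> card ` Pow V"
    using assms(2) by auto
  then show ?thesis
    using assms(1) by (meson finite_Pow_iff finite_imageI finite_subset)
qed

lemma card_le_Max_card:
  assumes "finite V" "\<And>A. P A \<Longrightarrow> A \<subseteq> V" "P A"
  shows "card A \<le> Max {card A | A. P A}"
  using finite_card_Collect[OF assms(1,2)] assms(3) by (auto intro!: Max_ge)

text \<open>A maximum over a finite set is attained once that set is nonempty; \<open>B\<close> only
  supplies the nonemptiness, and the empty set serves as \<open>B\<close> in every use
  below.\<close>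

lemma Max_card_obtain:
  assumes "finite V" "\<And>A. P A \<Longrightarrow> A \<subseteq> V" "P B"
  obtains A where "P A" "Max {card A | A. P A} = card A"
proof -
  have "finite {card A | A. P A}"
    using finite_card_Collect assms(1,2) by blast
  then have "Max {card A | A. P A} \<in> {card A | A. P A}"
    using assms(3) by (intro Max_in) auto
  then show ?thesis
    using that by auto
qed

section \<open>Real inequalities behind the two upper bounds\<close>

lemma quadratic_root_bound:
  fixes x b c :: real
  assumes "x\<^sup>2 \<le> b * x + c"
  shows "x \<le> b / 2 + sqrt (b\<^sup>2 / 4 + c)"
proof -
  \<comment> \<open>Completing the square bounds \<open>x - b / 2\<close> by the root, and also
    shows that the radicand is nonnegative.\<close>
  have "(x - b / 2)\<^sup>2 \<le> b\<^sup>2 / 4 + c"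
    using assms by (simp add: power2_eq_square algebra_simps)
  then show ?thesis
    using real_le_rsqrt by fastforce
qed

text \<open>The sum is split over \<open>A\<close> and \<open>V - A\<close>. The bound
  \<open>q\<close> is asked on all of \<open>V\<close>, as the extreme degrees provide it, and the
  size of the complement is a real difference so that the result is a polynomial in
  \<open>card A\<close>.\<close>

lemma sum_split_bounds:
  fixes f :: "'a \<Rightarrow> real" and p q :: real
  assumes "finite V" "A \<subseteq> V"
  shows "(\<And>v. v \<in> A \<Longrightarrow> f v \<le> p) \<Longrightarrow> (\<And>v. v \<in> V \<Longrightarrow> f v \<le> q) \<Longrightarrow>
           sum f V \<le> card A * p + (real (card V) - card A) * q"
    and "(\<And>v. v \<in> A \<Longrightarrow> p \<le> f v) \<Longrightarrow> (\<And>v. v \<in> V \<Longrightarrow> q \<le> f v) \<Longrightarrow>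
           card A * p + (real (card V) - card A) * q \<le> sum f V"
proof -
  have fin: "finite A"
    using assms finite_subset by blast
  have split: "sum f V = sum f A + sum f (V - A)"
    using assms by (simp add: sum.subset_diff)
  have card: "real (card (V - A)) = real (card V) - card A"
    using assms fin by (simp add: card_Diff_subset card_mono of_nat_diff)
  show "sum f V \<le> card A * p + (real (card V) - card A) * q"
    if "\<And>v. v \<in> A \<Longrightarrow> f v \<le> p" "\<And>v. v \<in> V \<Longrightarrow> f v \<le> q"
    using sum_bounded_above[of A f p] sum_bounded_above[of "V - A" f q] that card split by auto
  show "card A * p + (real (card V) - card A) * q \<le> sum f V"
    if "\<And>v. v \<in> A \<Longrightarrow> p \<le> f v" "\<And>v. v \<in> V \<Longrightarrow> q \<le> f v"
    using sum_bounded_below[of A p f] sum_bounded_below[of "V - A" q f] that card split by auto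
qed

section \<open>Degrees and the degree sum\<close>

context
  fixes V :: "'a set" and E :: "'a set set"
  assumes graph: "simple_graph V E"
begin

lemma finite_vertices: "finite V"
  using graph by (simp add: simple_graph_def)

lemma nbhd_subset: "nbhd V E v \<subseteq> V - {v}"
  using graph by (auto simp: nbhd_def simple_graph_def nsets_def)

lemma finite_nbhd: "finite (nbhd V E v)"
  using nbhd_subset finite_vertices by (meson finite_Diff finite_subset)

lemma deg_less_card: "v \<in> V \<Longrightarrow> deg V E v < card V"
  using psubset_card_mono[of V "nbhd V E v"] nbhd_subset[of v] finite_vertices
  by (auto simp: deg_def)

text \<open>Sending a neighbor \<open>u\<close> to \<open>{v, u}\<close> is a bijection onto the
  edges at \<open>v\<close>. This turns degrees into incidence counts for the double counting
  below.\<close>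

lemma deg_eq_card_incident:
  assumes "v \<in> V"
  shows "deg V E v = card {e \<in> E. v \<in> e}"
proof -
  have "{e \<in> E. v \<in> e} = (\<lambda>u. {v, u}) ` nbhd V E v"
  proof (intro equalityI subsetI)
    fix e assume "e \<in> {e \<in> E. v \<in> e}"
    then have e: "e \<in> E" "v \<in> e" "e \<subseteq> V" "card e = 2"
      using graph by (auto simp: simple_graph_def nsets_def)
    then obtain u where "e = {v, u}"
      by (metis card_2_iff doubleton_eq_iff insert_iff singletonD)
    then show "e \<in> (\<lambda>u. {v, u}) ` nbhd V E v"
      using e by (auto simp: nbhd_def)
  qed (auto simp: nbhd_def)
  moreover have "inj_on (\<lambda>u. {v, u}) (nbhd V E v)"
    by (auto simp: inj_on_def doubleton_eq_iff)
  ultimately show ?thesis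
    by (simp add: deg_def card_image)
qed

lemma degree_sum: "(\<Sum>v\<in>V. deg V E v) = 2 * card E"
proof -
  have sub: "E \<subseteq> nsets V 2"
    using graph by (simp add: simple_graph_def)
  then have fin: "finite E"
    using finite_vertices finite_imp_finite_nsets finite_subset by blast
  have "card {v \<in> V. v \<in> e} = 2" if "e \<in> E" for e
  proof -
    have "{v \<in> V. v \<in> e} = e"
      using sub that by (auto simp: nsets_def)
    then show ?thesis
      using sub that by (auto simp: nsets_def)
  qed
  \<comment> \<open>Incident pairs of a vertex and an edge are counted from both sides; each edge
    contributes its two ends.\<close>
  then have "(\<Sum>v\<in>V. card {e \<in> E. v \<in> e}) = (\<Sum>e\<in>E. 2)"
    by (intro sum_multicount_gen finite_vertices fin) auto
  then show ?thesis
    by (simp add: deg_eq_card_incident)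
qed

lemma deg_le_max_deg: "v \<in> V \<Longrightarrow> deg V E v \<le> max_deg V E"
  and min_deg_le_deg: "v \<in> V \<Longrightarrow> min_deg V E \<le> deg V E v"
  using finite_vertices by (auto simp: max_deg_def min_deg_def)

section \<open>The first inequality of each chain\<close>

lemma k_independent_imp_k_small:
  assumes "k_independent k V E A"
  shows "k_small k V E A"
proof -
  have A: "A \<subseteq> V" "finite A"
    using assms finite_vertices finite_subset by (auto simp: k_independent_def)
  have "deg V E v + card A \<le> card V + k" if "v \<in> A" for v
  proof -
    \<comment> \<open>At most \<open>k\<close> neighbors of \<open>v\<close> lie in
      \<open>A\<close>, and the remaining ones fit into \<open>V - A\<close>.\<close>
    have "deg V E v \<le> card (nbhd V E v \<inter> A) + card (nbhd V E v - A)"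
      using card_Int_Diff[OF finite_nbhd, of v A] by (simp add: deg_def)
    moreover have "card (nbhd V E v - A) \<le> card (V - A)"
      using nbhd_subset finite_vertices by (intro card_mono) auto
    moreover have "card (V - A) + card A = card V"
      using A finite_vertices by (simp add: card_Diff_subset card_mono)
    ultimately show ?thesis
      using assms that by (fastforce simp: k_independent_def)
  qed
  then show ?thesis
    using A by (fastforce simp: k_small_def)
qed

lemma k_near_clique_imp_k_large:
  assumes "k_near_clique k V E B"
  shows "k_large k V E B"
proof -
  have "card (nbhd V E v \<inter> B) \<le> deg V E v" for v
    unfolding deg_def by (intro card_mono finite_nbhd) auto
  then have "int (card (nbhd V E v \<inter> B)) \<le> int (deg V E v)" for v
    by simp
  then show ?thesis
    using assms order_trans unfolding k_near_clique_def k_large_def by blast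
qed

lemma k_small_card_le: "k_small k V E A \<Longrightarrow> card A \<le> small_num k V E"
  unfolding small_num_def
  by (rule card_le_Max_card[OF finite_vertices]) (auto simp: k_small_def)

lemma k_large_card_le: "k_large k V E B \<Longrightarrow> card B \<le> large_num k V E"
  unfolding large_num_def
  by (rule card_le_Max_card[OF finite_vertices]) (auto simp: k_large_def)

lemma small_num_obtain:
  obtains A where "k_small k V E A" "small_num k V E = card A"
  unfolding small_num_def
  by (rule Max_card_obtain[OF finite_vertices, of "k_small k V E" "{}"]) (auto simp: k_small_def)

lemma large_num_obtain:
  obtains B where "k_large k V E B" "large_num k V E = card B"
  unfolding large_num_def
  by (rule Max_card_obtain[OF finite_vertices, of "k_large k V E" "{}"]) (auto simp: k_large_def)

lemma indep_num_le_small_num: "indep_num k V E \<le> small_num k V E"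
proof -
  obtain A where "k_independent k V E A" "indep_num k V E = card A"
    unfolding indep_num_def
    by (rule Max_card_obtain[OF finite_vertices, of "k_independent k V E" "{}"])
       (auto simp: k_independent_def)
  then show ?thesis
    by (simp add: k_independent_imp_k_small k_small_card_le)
qed

lemma near_clique_num_le_large_num: "near_clique_num k V E \<le> large_num k V E"
proof -
  obtain B where "k_near_clique k V E B" "near_clique_num k V E = card B"
    unfolding near_clique_num_def
    by (rule Max_card_obtain[OF finite_vertices, of "k_near_clique k V E" "{}"])
       (auto simp: k_near_clique_def)
  then show ?thesis
    by (simp add: k_near_clique_imp_k_large k_large_card_le)
qed

section \<open>The second inequality of each chain\<close>

lemma real_degree_sum: "(\<Sum>v\<in>V. real (deg V E v)) = 2 * real (card E)"
  using degree_sum by (metis of_nat_mult of_nat_numeral of_nat_sum)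

lemma small_num_le_small_bound: "real (small_num k V E) \<le> small_bound k V E"
proof -
  obtain A where A: "k_small k V E A" "small_num k V E = card A"
    by (rule small_num_obtain)
  define n s D m where "n = real (card V)" and "s = real (card A)"
    and "D = real (max_deg V E)" and "m = real (card E)"
  have "real (deg V E v) \<le> n - s + k" if "v \<in> A" for v
    using A(1) that by (fastforce simp: k_small_def n_def s_def)
  \<comment> \<open>Vertices of \<open>A\<close> have their degree bounded by smallness, all others
    by the maximum degree.\<close>
  then have "2 * m \<le> s * (n - s + k) + (n - s) * D"
    using sum_split_bounds(1)[OF finite_vertices, of A "\<lambda>v. real (deg V E v)" "n - s + real k" D]
      A(1) deg_le_max_deg by (simp add: k_small_def real_degree_sum n_def s_def D_def m_def)
  then have "s\<^sup>2 \<le> (n - D + k) * s + (n * D - 2 * m)"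
    by (simp add: power2_eq_square algebra_simps)
  from quadratic_root_bound[OF this] show ?thesis
    by (simp add: A(2) small_bound_def Let_def n_def s_def D_def m_def algebra_simps)
qed

lemma large_num_le_large_bound: "real (large_num k V E) \<le> large_bound k V E"
proof -
  obtain B where B: "k_large k V E B" "large_num k V E = card B"
    by (rule large_num_obtain)
  define n s d m where "n = real (card V)" and "s = real (card B)"
    and "d = real (min_deg V E)" and "m = real (card E)"
  have "s - k - 1 \<le> real (deg V E v)" if "v \<in> B" for v
    using B(1) that by (fastforce simp: k_large_def s_def)
  \<comment> \<open>Dually, largeness bounds degrees in \<open>B\<close> from below, and the minimum
    degree does so elsewhere.\<close>
  then have "s * (s - k - 1) + (n - s) * d \<le> 2 * m"
    using sum_split_bounds(2)[OF finite_vertices, of B "s - real k - 1" "\<lambda>v. real (deg V E v)" d]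
      B(1) min_deg_le_deg by (simp add: k_large_def real_degree_sum n_def s_def d_def m_def)
  then have "s\<^sup>2 \<le> (d + k + 1) * s + (2 * m - n * d)"
    by (simp add: power2_eq_square algebra_simps)
  from quadratic_root_bound[OF this] show ?thesis
    by (simp add: B(2) large_bound_def Let_def n_def s_def d_def m_def algebra_simps)
qed

section \<open>Equality in the second inequalities for regular graphs\<close>

lemma regular_deg:
  assumes "regular V E"
  shows "v \<in> V \<Longrightarrow> deg V E v = max_deg V E" and "min_deg V E = max_deg V E"
    and "card V * max_deg V E = 2 * card E"
proof -
  obtain r where r: "\<And>v. v \<in> V \<Longrightarrow> deg V E v = r"
    using assms by (auto simp: regular_def)
  \<comment> \<open>The image is a singleton and not empty because \<open>V\<close> is
    nonempty.\<close>
  have "deg V E ` V = {r}"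
    using r graph by (auto simp: simple_graph_def)
  then have *: "max_deg V E = r" "min_deg V E = r"
    by (auto simp: max_deg_def min_deg_def)
  show "v \<in> V \<Longrightarrow> deg V E v = max_deg V E" and "min_deg V E = max_deg V E"
    using r * by auto
  show "card V * max_deg V E = 2 * card E"
    using degree_sum r * by simp
qed

text \<open>Keeps the natural subtraction \<open>card V - max_deg V E\<close> from
  truncating.\<close>

lemma max_deg_less_card: "max_deg V E < card V"
  using deg_less_card finite_vertices graph by (auto simp: max_deg_def simple_graph_def)

lemma regular_small_bound:
  assumes "regular V E"
  shows "small_bound k V E = real (card V - max_deg V E + k)"
proof -
  have e: "real (card V) * real (max_deg V E) = 2 * real (card E)"
    using regular_deg(3)[OF assms] by (metis of_nat_mult of_nat_numeral)
  \<comment> \<open>By \<open>e\<close> the radicand reduces to the square of half of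
    \<open>n - D + k\<close>, which is nonnegative, so two equal halves add up.\<close>
  then show ?thesis
    using max_deg_less_card by (simp add: small_bound_def Let_def e real_sqrt_divide of_nat_diff)
qed

lemma regular_large_bound:
  assumes "regular V E"
  shows "large_bound k V E = real (min_deg V E + k + 1)"
proof -
  have e: "real (card V) * real (min_deg V E) = 2 * real (card E)"
    using regular_deg[OF assms] by (metis of_nat_mult of_nat_numeral)
  then show ?thesis
    by (simp add: large_bound_def Let_def e real_sqrt_divide)
qed

lemma regular_small_num:
  assumes "regular V E" "k \<le> max_deg V E"
  shows "real (small_num k V E) = small_bound k V E"
proof -
  \<comment> \<open>The assumption \<open>k \<le> max_deg V E\<close> is what lets a set of this
    size fit into \<open>V\<close>.\<close>
  have "card V - max_deg V E + k \<le> card V"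
    using assms(2) max_deg_less_card by linarith
  then obtain A where A: "A \<subseteq> V" "card A = card V - max_deg V E + k"
    using obtain_subset_with_card_n by metis
  \<comment> \<open>For this size of \<open>A\<close> the threshold \<open>n - |A| + k\<close> is
    exactly the common degree.\<close>
  then have "k_small k V E A"
    using regular_deg(1)[OF assms(1)] max_deg_less_card by (force simp: k_small_def)
  then show ?thesis
    using A(2) k_small_card_le small_num_le_small_bound[of k] regular_small_bound[OF assms(1)]
    by (metis of_nat_le_iff order_antisym)
qed

lemma regular_large_num:
  assumes "regular V E" "min_deg V E + k + 1 \<le> card V"
  shows "real (large_num k V E) = large_bound k V E"
proof -
  obtain B where B: "B \<subseteq> V" "card B = min_deg V E + k + 1"
    using obtain_subset_with_card_n assms(2) by metis
  \<comment> \<open>Likewise \<open>|B| - k - 1\<close> is exactly the common degree.\<close>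
  then have "k_large k V E B"
    using regular_deg(1,2)[OF assms(1)] by (force simp: k_large_def)
  then show ?thesis
    using B(2) k_large_card_le large_num_le_large_bound[of k] regular_large_bound[OF assms(1)]
    by (metis of_nat_le_iff order_antisym)
qed

section \<open>Lower bounds from arbitrary sets of \<open>k + 1\<close> vertices\<close>

lemma Suc_le_indep_num:
  assumes "k < card V"
  shows "Suc k \<le> indep_num k V E"
proof -
  obtain A where A: "A \<subseteq> V" "card A = Suc k" "finite A"
    using obtain_subset_with_card_n assms by (metis Suc_leI)
  have "card (nbhd V E v \<inter> A) \<le> k" if "v \<in> A" for v
  proof -
    \<comment> \<open>There are no loops, so only the \<open>k\<close> other vertices of
      \<open>A\<close> can be neighbors of \<open>v\<close>.\<close>
    have "card (nbhd V E v \<inter> A) \<le> card (A - {v})"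
      using A(3) nbhd_subset[of v] by (intro card_mono) auto
    then show ?thesis
      using A that by simp
  qed
  then have "k_independent k V E A"
    using A by (simp add: k_independent_def)
  then have "card A \<le> indep_num k V E"
    unfolding indep_num_def
    by (rule card_le_Max_card[OF finite_vertices, rotated]) (auto simp: k_independent_def)
  then show ?thesis
    using A(2) by simp
qed

lemma Suc_le_near_clique_num:
  assumes "k < card V"
  shows "Suc k \<le> near_clique_num k V E"
proof -
  obtain B where B: "B \<subseteq> V" "card B = Suc k"
    using obtain_subset_with_card_n assms by (metis Suc_leI)
  \<comment> \<open>The required number of neighbors \<open>|B| - k - 1\<close> is zero.\<close>
  then have "k_near_clique k V E B"
    by (simp add: k_near_clique_def)
  then have "card B \<le> near_clique_num k V E"
    unfolding near_clique_num_def
    by (rule card_le_Max_card[OF finite_vertices, rotated]) (auto simp: k_near_clique_def)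
  then show ?thesis
    using B(2) by simp
qed

end

section \<open>Regular graphs attaining equality throughout each chain\<close>

lemma complete_graph_attains_small_bound:
  assumes "finite W" "k < card W"
  defines "F \<equiv> nsets W 2"
  shows "simple_graph W F" "regular W F" "indep_num k W F = small_num k W F"
    "real (small_num k W F) = small_bound k W F"
proof -
  show graph: "simple_graph W F"
    using assms by (auto simp: simple_graph_def)
  have "nbhd W F v = W - {v}" if "v \<in> W" for v
    using that by (auto simp: F_def nbhd_def nsets_def card_2_iff)
  then have deg: "deg W F v = card W - 1" if "v \<in> W" for v
    using that assms(1) by (simp add: deg_def)
  then show reg: "regular W F"
    by (auto simp: regular_def)
  have "W \<noteq> {}"
    using assms(2) by auto
  then have "max_deg W F = card W - 1"
    using deg regular_deg(1)[OF graph reg] by auto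
  then have "small_bound k W F = real (Suc k)"
    using assms(2) regular_small_bound[OF graph reg] by simp
  \<comment> \<open>The chain starts at no less than \<open>Suc k\<close> and ends at
    \<open>Suc k\<close>, so all its members agree.\<close>
  then show "indep_num k W F = small_num k W F" "real (small_num k W F) = small_bound k W F"
    using Suc_le_indep_num[OF graph assms(2)] indep_num_le_small_num[OF graph, of k]
      small_num_le_small_bound[OF graph, of k] by simp_all
qed

lemma edgeless_graph_attains_large_bound:
  assumes "finite W" "k < card W"
  shows "simple_graph W {}" "regular W {}" "near_clique_num k W {} = large_num k W {}"
    "real (large_num k W {}) = large_bound k W {}"
proof -
  show graph: "simple_graph W {}"
    using assms by (auto simp: simple_graph_def)
  have deg: "deg W {} v = 0" for v
    by (simp add: deg_def nbhd_def)
  then show reg: "regular W {}"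
    by (auto simp: regular_def)
  have "W \<noteq> {}"
    using assms(2) by auto
  then have "min_deg W {} = 0"
    using deg min_deg_le_deg[OF graph] by fastforce
  then have "large_bound k W {} = real (Suc k)"
    using regular_large_bound[OF graph reg] by simp
  then show "near_clique_num k W {} = large_num k W {}"
    "real (large_num k W {}) = large_bound k W {}"
    using Suc_le_near_clique_num[OF graph assms(2)] near_clique_num_le_large_num[OF graph, of k]
      large_num_le_large_bound[OF graph, of k] by simp_all
qed

theorem theorem5p1:
  fixes k :: nat and V :: "'a set" and E :: "'a set set"
  assumes "simple_graph V E"
  shows "(indep_num k V E \<le> small_num k V E \<and>
          real (small_num k V E) \<le> small_bound k V E) \<and>
         (near_clique_num k V E \<le> large_num k V E \<and>
          real (large_num k V E) \<le> large_bound k V E) \<and>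
         (regular V E \<longrightarrow>
            (k \<le> max_deg V E \<longrightarrow> real (small_num k V E) = small_bound k V E) \<and>
            (min_deg V E + k + 1 \<le> card V \<longrightarrow> real (large_num k V E) = large_bound k V E)) \<and>
         (\<forall>m>k. \<exists>(W :: nat set) F. simple_graph W F \<and> regular W F \<and> card W = m \<and>
            indep_num k W F = small_num k W F \<and> real (small_num k W F) = small_bound k W F) \<and>
         (\<forall>m>k. \<exists>(W :: nat set) F. simple_graph W F \<and> regular W F \<and> card W = m \<and>
            near_clique_num k W F = large_num k W F \<and> real (large_num k W F) = large_bound k W F)"
proof (intro conjI impI allI)
  fix m assume "m > k"
  \<comment> \<open>Both witnesses have the vertex set \<open>{..<m}\<close>: the first is complete,
    the second edgeless.\<close>
  then have W: "finite {..<m}" "k < card {..<m}"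
    by auto
  show "\<exists>(W :: nat set) F. simple_graph W F \<and> regular W F \<and> card W = m \<and>
      indep_num k W F = small_num k W F \<and> real (small_num k W F) = small_bound k W F"
    using complete_graph_attains_small_bound[OF W] by (metis card_lessThan)
  show "\<exists>(W :: nat set) F. simple_graph W F \<and> regular W F \<and> card W = m \<and>
      near_clique_num k W F = large_num k W F \<and> real (large_num k W F) = large_bound k W F"
    using edgeless_graph_attains_large_bound[OF W] by (metis card_lessThan)
qed (simp_all add: assms indep_num_le_small_num small_num_le_small_bound
      near_clique_num_le_large_num large_num_le_large_bound regular_small_num regular_large_num)

end
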